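(* Let $L_E\subset\mathbb{O}$ be the Coxeter--Dickson order and let $R=\{x\in L_E: n(x)=1\}$ be its set of $240$ roots. Then $R$ is closed under the para-octonionic product $x\bullet y=\overline{x}\cdot\overline{y}$ and under the Okubo product $x*y=\tau(\overline{x})\cdot\tau^2(\overline{y})$, and both $(R,\bullet)$ and $(R,* )$ are quasigroups. In $(R,\bullet)$ the element $1$ is a paraunit, satisfying $1\bullet x=x\bullet 1=\overline{x}$ for all $x\in R$, and there is no identity element; $(R,* )$ has neither an identity element nor a paraunit.
   Context: Octonions: $\mathbb{O}$ is the real algebra with basis $e_0=1,e_1,\dots,e_7$, where $1$ is the unit, $e_k^2=-1$ for $k\ge 1$, $e_ie_j=-e_je_i$ for distinct $i,j\geq 1$, and $e_ie_j=e_k$ whenever $(i,j,k)$ is a cyclic permutation of one of the seven oriented triples $(1,2,4),(1,3,7),(2,3,6),(4,3,5),(6,1,5),(5,2,7),(7,4,6)$. Conjugation is $\overline{x_0+\sum_{k\ge1} x_ke_k}=x_0-\sum_{k\ge1} x_ke_k$ and the norm is $n(x)=\sum_{k=0}^7x_k^2$. The automorphism $\tau$ of $\mathbb{O}$ is the linear map with $\tau(1)=1$, $\tau(e_3)=e_3$, $\tau(e_1)=e_2$, $\tau(e_2)=-e_4$, $\tau(e_4)=-e_1$, $\tau(e_5)=-e_7$, $\tau(e_7)=e_6$, $\tau(e_6)=-e_5$. $L_E$ is the $\mathbb{Z}$-span of $1,e_1,e_2,e_3,h,e_1h,e_2h,e_3h$ with $h=\frac{e_1+e_2+e_3+e_4}{2}$.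 A quasigroup is a set with a binary operation for which all left and right multiplications by a fixed element are bijections. An identity for an operation $\circ$ is an element $u$ with $u\circ x=x\circ u=x$ for all $x$. A paraunit for $\circ$ is an element $p$ for which there is an involution $\varphi$ (a map with $\varphi\circ\varphi=\mathrm{id}$ and $\varphi(x\circ y)=\varphi(y)\circ\varphi(x)$) such that $p\circ x=x\circ p=\varphi(x)$ for all $x$. *)

theory Defs
  imports "HOL-Analysis.Analysis"
begin

section \<open>Octonions\<close>

text \<open>
  The octonions are carried by \<^typ>\<open>real ^ 8\<close>, with coordinates indexed by \<open>0, \<dots>, 7 :: 8\<close>.
  Only the real vector space structure of \<^typ>\<open>real ^ 8\<close> is used: its library product
  \<^term>\<open>(*)\<close> and its unit \<^term>\<open>1\<close> are componentwise and are \<^emph>\<open>not\<close> the octonionic ones.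
  The octonionic product is \<open>\<cdot>\<^sub>O\<close> below, and the octonionic unit is \<open>oe 0\<close>.
\<close>

type_synonym octonion = "real ^ 8"

definition oe :: "8 \<Rightarrow> octonion" where
  "oe k = axis k 1"

definition oct_triples :: "(8 \<times> 8 \<times> 8) set" where
  "oct_triples = {(1,2,4), (1,3,7), (2,3,6), (4,3,5), (6,1,5), (5,2,7), (7,4,6)}"

definition oct_cycles :: "(8 \<times> 8 \<times> 8) set" where
  "oct_cycles =
     oct_triples \<union> (\<lambda>(i, j, k). (j, k, i)) ` oct_triples \<union> (\<lambda>(i, j, k). (k, i, j)) ` oct_triples"

text \<open>
  For distinct nonzero \<open>i\<close>, \<open>j\<close>, exactly one of the two sums below is nonempty, and that one has
  exactly one term, because every pair lies in exactly one triple.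
\<close>

definition oct_basis_mult :: "8 \<Rightarrow> 8 \<Rightarrow> octonion" where
  "oct_basis_mult i j =
     (if i = 0 then oe j
      else if j = 0 then oe i
      else if i = j then - oe 0
      else (\<Sum>k | (i, j, k) \<in> oct_cycles. oe k) - (\<Sum>k | (j, i, k) \<in> oct_cycles. oe k))"

definition oct_mult :: "octonion \<Rightarrow> octonion \<Rightarrow> octonion" (infixl "\<cdot>\<^sub>O" 70) where
  "x \<cdot>\<^sub>O y = (\<Sum>i\<in>UNIV. \<Sum>j\<in>UNIV. (x $ i * y $ j) *\<^sub>R oct_basis_mult i j)"

definition oct_cnj :: "octonion \<Rightarrow> octonion" where
  "oct_cnj x = (\<chi> k. if k = 0 then x $ k else - x $ k)"

definition oct_norm :: "octonion \<Rightarrow> real" where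
  "oct_norm x = (\<Sum>k\<in>UNIV. (x $ k)\<^sup>2)"

definition oct_tau :: "octonion \<Rightarrow> octonion" where
  "oct_tau x =
     x $ 0 *\<^sub>R oe 0 + x $ 3 *\<^sub>R oe 3
     + x $ 1 *\<^sub>R oe 2 + x $ 2 *\<^sub>R (- oe 4) + x $ 4 *\<^sub>R (- oe 1)
     + x $ 5 *\<^sub>R (- oe 7) + x $ 7 *\<^sub>R oe 6 + x $ 6 *\<^sub>R (- oe 5)"

definition para_mult :: "octonion \<Rightarrow> octonion \<Rightarrow> octonion" where
  "para_mult x y = oct_cnj x \<cdot>\<^sub>O oct_cnj y"

definition okubo_mult :: "octonion \<Rightarrow> octonion \<Rightarrow> octonion" where
  "okubo_mult x y = oct_tau (oct_cnj x) \<cdot>\<^sub>O (oct_tau ^^ 2) (oct_cnj y)"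


section \<open>The Coxeter--Dickson order and its roots\<close>

definition int_span :: "octonion set \<Rightarrow> octonion set" where
  "int_span = module.span (\<lambda>(m::int) x. of_int m *\<^sub>R x)"

definition oct_h :: octonion where
  "oct_h = (oe 1 + oe 2 + oe 3 + oe 4) /\<^sub>R 2"

definition coxeter_dickson :: "octonion set" where
  "coxeter_dickson =
     int_span {oe 0, oe 1, oe 2, oe 3, oct_h, oe 1 \<cdot>\<^sub>O oct_h, oe 2 \<cdot>\<^sub>O oct_h, oe 3 \<cdot>\<^sub>O oct_h}"

definition cd_roots :: "octonion set" where
  "cd_roots = {x \<in> coxeter_dickson. oct_norm x = 1}"


section \<open>Quasigroups, identities and paraunits\<close>

definition closed_under :: "'a set \<Rightarrow> ('a \<Rightarrow> 'a \<Rightarrow> 'a) \<Rightarrow> bool" where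
  "closed_under S f \<longleftrightarrow> (\<forall>x\<in>S. \<forall>y\<in>S. f x y \<in> S)"

definition quasigroup :: "'a set \<Rightarrow> ('a \<Rightarrow> 'a \<Rightarrow> 'a) \<Rightarrow> bool" where
  "quasigroup S f \<longleftrightarrow>
     closed_under S f \<and>
     (\<forall>a\<in>S. bij_betw (\<lambda>x. f a x) S S \<and> bij_betw (\<lambda>x. f x a) S S)"

definition identity_elt :: "'a set \<Rightarrow> ('a \<Rightarrow> 'a \<Rightarrow> 'a) \<Rightarrow> 'a \<Rightarrow> bool" where
  "identity_elt S f u \<longleftrightarrow> u \<in> S \<and> (\<forall>x\<in>S. f u x = x \<and> f x u = x)"

definition involution_on :: "'a set \<Rightarrow> ('a \<Rightarrow> 'a \<Rightarrow> 'a) \<Rightarrow> ('a \<Rightarrow> 'a) \<Rightarrow> bool" where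
  "involution_on S f \<phi> \<longleftrightarrow>
     \<phi> \<in> S \<rightarrow> S \<and> (\<forall>x\<in>S. \<phi> (\<phi> x) = x) \<and> (\<forall>x\<in>S. \<forall>y\<in>S. \<phi> (f x y) = f (\<phi> y) (\<phi> x))"

definition paraunit :: "'a set \<Rightarrow> ('a \<Rightarrow> 'a \<Rightarrow> 'a) \<Rightarrow> 'a \<Rightarrow> bool" where
  "paraunit S f p \<longleftrightarrow>
     p \<in> S \<and> (\<exists>\<phi>. involution_on S f \<phi> \<and> (\<forall>x\<in>S. f p x = \<phi> x \<and> f x p = \<phi> x))"


section \<open>Basic facts confirming the definitions\<close>

lemma exhaust_8:
  fixes x :: 8
  shows "x = 0 \<or> x = 1 \<or> x = 2 \<or> x = 3 \<or> x = 4 \<or> x = 5 \<or> x = 6 \<or> x = 7"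
proof (induct x)
  case (of_int z)
  then have "z = 0 \<or> z = 1 \<or> z = 2 \<or> z = 3 \<or> z = 4 \<or> z = 5 \<or> z = 6 \<or> z = 7" by fastforce
  then show ?case by auto
qed

lemma UNIV_8: "(UNIV :: 8 set) = {0, 1, 2, 3, 4, 5, 6, 7}"
  using exhaust_8 by auto

lemma sum_8: "sum f (UNIV :: 8 set) = f 0 + f 1 + f 2 + f 3 + f 4 + f 5 + f 6 + f 7"
  unfolding UNIV_8 by (simp add: add.assoc)

lemma forall_8: "(\<forall>i::8. P i) \<longleftrightarrow> P 0 \<and> P 1 \<and> P 2 \<and> P 3 \<and> P 4 \<and> P 5 \<and> P 6 \<and> P 7"
  by (metis exhaust_8)

lemma bilinear_oct_mult: "bilinear (\<cdot>\<^sub>O)"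
  unfolding bilinear_def
  by (auto intro!: linearI
      simp: oct_mult_def algebra_simps sum.distrib scaleR_sum_right)

lemma oct_mult_oe: "oe i \<cdot>\<^sub>O oe j = oct_basis_mult i j"
proof -
  have "oe i \<cdot>\<^sub>O oe j =
      (\<Sum>k\<in>UNIV. \<Sum>l\<in>UNIV. if k = i then (if l = j then oct_basis_mult k l else 0) else 0)"
    unfolding oct_mult_def by (intro sum.cong refl) (auto simp: oe_def axis_def)
  also have "\<dots> = (\<Sum>k\<in>UNIV. if k = i then oct_basis_mult k j else 0)"
    by (intro sum.cong refl) auto
  finally show ?thesis by simp
qed

lemma oct_mult_unit: "oe 0 \<cdot>\<^sub>O oe j = oe j" "oe j \<cdot>\<^sub>O oe 0 = oe j"
  by (simp_all add: oct_mult_oe oct_basis_mult_def)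

lemma oct_mult_square: "k \<noteq> 0 \<Longrightarrow> oe k \<cdot>\<^sub>O oe k = - oe 0"
  by (simp add: oct_mult_oe oct_basis_mult_def)

lemma oct_mult_anticommute:
  "i \<noteq> 0 \<Longrightarrow> j \<noteq> 0 \<Longrightarrow> i \<noteq> j \<Longrightarrow> oe i \<cdot>\<^sub>O oe j = - (oe j \<cdot>\<^sub>O oe i)"
  by (simp add: oct_mult_oe oct_basis_mult_def)

lemma oct_cycles_eq:
  "oct_cycles =
     {(1,2,4), (1,3,7), (2,3,6), (4,3,5), (6,1,5), (5,2,7), (7,4,6),
      (2,4,1), (3,7,1), (3,6,2), (3,5,4), (1,5,6), (2,7,5), (4,6,7),
      (4,1,2), (7,1,3), (6,2,3), (5,4,3), (5,6,1), (7,5,2), (6,7,4)}"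
  unfolding oct_cycles_def oct_triples_def
  by (simp only: image_insert image_empty prod.case Un_insert_left Un_empty_left Un_empty_right)

lemma oct_mult_cycle:
  assumes "(i, j, k) \<in> oct_cycles"
  shows "oe i \<cdot>\<^sub>O oe j = oe k"
proof -
  have "{l. (i, j, l) \<in> oct_cycles} = {k}" "{l. (j, i, l) \<in> oct_cycles} = {}"
    "i \<noteq> 0" "j \<noteq> 0" "i \<noteq> j"
    using assms unfolding oct_cycles_eq by (elim insertE; simp)+
  then show ?thesis
    by (simp add: oct_mult_oe oct_basis_mult_def)
qed

lemma linear_oct_tau: "linear oct_tau"
  by (rule linearI) (simp_all add: oct_tau_def algebra_simps)

lemma oct_tau_oe:
  "oct_tau (oe 0) = oe 0" "oct_tau (oe 3) = oe 3"
  "oct_tau (oe 1) = oe 2" "oct_tau (oe 2) = - oe 4" "oct_tau (oe 4) = - oe 1"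
  "oct_tau (oe 5) = - oe 7" "oct_tau (oe 7) = oe 6" "oct_tau (oe 6) = - oe 5"
  by (simp_all add: oct_tau_def oe_def axis_def)

lemma module_int_octonion: "module (\<lambda>(m::int) (x::octonion). of_int m *\<^sub>R x)"
  by unfold_locales (simp_all add: algebra_simps)

end

theory Submission
  imports Defs
begin

text \<open>
  The order \<open>L\<^sub>E\<close> is cut out by eight integrality conditions, which say that \<open>2x\<close> is an integer
  vector reducing modulo 2 to a word of the extended Hamming code; counting the vectors \<open>2x\<close> of squared
  length 4 gives 240. Closure under the octonionic product, conjugation and \<open>\<tau>\<close> only has to be
  checked on a basis. Since the norm is multiplicative there are no zero divisors, so translations
  by roots are injective, hence bijective on the finite set of roots. An identity or a paraunit
  \<open>p\<close> of the Okubo product would satisfy \<open>p * x = x * p\<close> for all roots \<open>x\<close>, and taking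
  \<open>x = e\<^sub>0, e\<^sub>3, e\<^sub>1\<close> already forces \<open>p = 0\<close>.
\<close>

section \<open>Octonion operations in coordinates\<close>

lemma oe_nth: "oe i $ j = (if i = j then 1 else 0)"
  by (simp add: oe_def axis_def)

lemma oct_mult_nth:
  "(x \<cdot>\<^sub>O y) $ 0 = x$0 * y$0 - x$1 * y$1 - x$2 * y$2 - x$3 * y$3
     - x$4 * y$4 - x$5 * y$5 - x$6 * y$6 - x$7 * y$7"
  "(x \<cdot>\<^sub>O y) $ 1 = x$0 * y$1 + x$1 * y$0 + x$2 * y$4 - x$4 * y$2 + x$3 * y$7 - x$7 * y$3
     + x$5 * y$6 - x$6 * y$5"
  "(x \<cdot>\<^sub>O y) $ 2 = x$0 * y$2 + x$2 * y$0 + x$4 * y$1 - x$1 * y$4 + x$3 * y$6 - x$6 * y$3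
     + x$7 * y$5 - x$5 * y$7"
  "(x \<cdot>\<^sub>O y) $ 3 = x$0 * y$3 + x$3 * y$0 + x$7 * y$1 - x$1 * y$7 + x$6 * y$2 - x$2 * y$6
     + x$5 * y$4 - x$4 * y$5"
  "(x \<cdot>\<^sub>O y) $ 4 = x$0 * y$4 + x$4 * y$0 + x$1 * y$2 - x$2 * y$1 + x$3 * y$5 - x$5 * y$3
     + x$6 * y$7 - x$7 * y$6"
  "(x \<cdot>\<^sub>O y) $ 5 = x$0 * y$5 + x$5 * y$0 + x$4 * y$3 - x$3 * y$4 + x$6 * y$1 - x$1 * y$6
     + x$2 * y$7 - x$7 * y$2"
  "(x \<cdot>\<^sub>O y) $ 6 = x$0 * y$6 + x$6 * y$0 + x$2 * y$3 - x$3 * y$2 + x$1 * y$5 - x$5 * y$1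
     + x$7 * y$4 - x$4 * y$7"
  "(x \<cdot>\<^sub>O y) $ 7 = x$0 * y$7 + x$7 * y$0 + x$1 * y$3 - x$3 * y$1 + x$5 * y$2 - x$2 * y$5
     + x$4 * y$6 - x$6 * y$4"
  by (simp_all add: oct_mult_def sum_8 oct_basis_mult_def oct_cycles_eq oe_nth)

lemma oct_cnj_nth:
  "oct_cnj x $ 0 = x$0" "k \<noteq> 0 \<Longrightarrow> oct_cnj x $ k = - x$k"
  by (simp_all add: oct_cnj_def)

lemma oct_tau_nth:
  "oct_tau x $ 0 = x$0" "oct_tau x $ 1 = - x$4" "oct_tau x $ 2 = x$1" "oct_tau x $ 3 = x$3"
  "oct_tau x $ 4 = - x$2" "oct_tau x $ 5 = - x$6" "oct_tau x $ 6 = x$7" "oct_tau x $ 7 = - x$5"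
  by (simp_all add: oct_tau_def oe_nth)

lemma linear_oct_cnj: "linear oct_cnj"
  by (rule linearI) (simp_all add: oct_cnj_def vec_eq_iff)

lemma oct_cnj_cnj [simp]: "oct_cnj (oct_cnj x) = x"
  by (simp add: oct_cnj_def vec_eq_iff)

lemma oct_cnj_mult: "oct_cnj (x \<cdot>\<^sub>O y) = oct_cnj y \<cdot>\<^sub>O oct_cnj x"
  by (simp add: vec_eq_iff forall_8 oct_cnj_nth oct_mult_nth algebra_simps)

lemma oct_mult_one [simp]: "oe 0 \<cdot>\<^sub>O x = x" "x \<cdot>\<^sub>O oe 0 = x"
  by (simp_all add: vec_eq_iff forall_8 oct_mult_nth oe_nth)

lemma oct_cnj_one [simp]: "oct_cnj (oe 0) = oe 0"
  by (simp add: vec_eq_iff oct_cnj_def oe_nth)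

text \<open>This is Degen's eight-square identity, verified by expanding both sides.\<close>

lemma oct_norm_mult: "oct_norm (x \<cdot>\<^sub>O y) = oct_norm x * oct_norm y"
  unfolding oct_norm_def sum_8 oct_mult_nth by (simp add: power2_eq_square algebra_simps)

lemma oct_norm_cnj: "oct_norm (oct_cnj x) = oct_norm x"
  by (simp add: oct_norm_def sum_8 oct_cnj_nth)

text \<open>In coordinates \<open>oct_tau\<close> is a signed permutation, so the squares are only
  rearranged.\<close>

lemma oct_norm_tau: "oct_norm (oct_tau x) = oct_norm x"
  by (simp add: oct_norm_def sum_8 oct_tau_nth)

lemma oct_norm_eq_0_iff: "oct_norm x = 0 \<longleftrightarrow> x = 0"
  by (simp add: oct_norm_def sum_nonneg_eq_0_iff vec_eq_iff)

lemma oct_mult_eq_0_iff: "x \<cdot>\<^sub>O y = 0 \<longleftrightarrow> x = 0 \<or> y = 0"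
  by (metis oct_norm_mult oct_norm_eq_0_iff mult_eq_0_iff)

text \<open>Cancellation rests on bilinearity and the absence of zero divisors, so non-associativity
  is no obstacle.\<close>

lemma oct_mult_left_cancel: "x \<noteq> 0 \<Longrightarrow> x \<cdot>\<^sub>O y = x \<cdot>\<^sub>O z \<longleftrightarrow> y = z"
  using bilinear_rsub[OF bilinear_oct_mult, of x y z] oct_mult_eq_0_iff[of x "y - z"] by auto

lemma oct_mult_right_cancel: "x \<noteq> 0 \<Longrightarrow> y \<cdot>\<^sub>O x = z \<cdot>\<^sub>O x \<longleftrightarrow> y = z"
  using bilinear_lsub[OF bilinear_oct_mult, of y z x] oct_mult_eq_0_iff[of "y - z" x] by auto

lemma inj_oct_cnj: "inj oct_cnj"
  by (metis injI oct_cnj_cnj)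

lemma inj_oct_tau: "inj oct_tau"
  by (rule injI) (simp add: vec_eq_iff forall_8 oct_tau_nth)

section \<open>The Coxeter-Dickson order in coordinates\<close>

abbreviation cd_basis :: "octonion set" where
  "cd_basis \<equiv> {oe 0, oe 1, oe 2, oe 3, oct_h, oe 1 \<cdot>\<^sub>O oct_h, oe 2 \<cdot>\<^sub>O oct_h, oe 3 \<cdot>\<^sub>O oct_h}"

interpretation zmod: module "\<lambda>(m::int) (x::octonion). of_int m *\<^sub>R x"
  by (rule module_int_octonion)

lemma oct_h_nth:
  "oct_h $ 0 = 0" "oct_h $ 1 = 1/2" "oct_h $ 2 = 1/2" "oct_h $ 3 = 1/2" "oct_h $ 4 = 1/2"
  "oct_h $ 5 = 0" "oct_h $ 6 = 0" "oct_h $ 7 = 0"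
  by (simp_all add: oct_h_def oe_nth)

text \<open>The eight linear forms serve as integral coordinates on the lattice: they are integral
  on the generators, and conversely integer values of the forms give integer coefficients in the
  generators.\<close>

lemma coxeter_dickson_iff:
  "x \<in> coxeter_dickson \<longleftrightarrow>
     2 * x$0 \<in> \<int> \<and> 2 * x$1 \<in> \<int> \<and> 2 * x$2 \<in> \<int> \<and> 2 * x$3 \<in> \<int> \<and>
     x$1 + x$2 + x$3 + x$4 \<in> \<int> \<and> x$0 + x$1 + x$2 + x$5 \<in> \<int> \<and>
     x$0 + x$2 + x$3 + x$6 \<in> \<int> \<and> x$0 + x$1 + x$3 + x$7 \<in> \<int>" (is "_ \<longleftrightarrow> ?P x")
proof
  \<comment> \<open>Each condition defines the preimage of the integers under a real linear form,
    which is an additive subgroup.\<close>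
  have sub: "zmod.subspace {x. f x \<in> \<int>}" if "linear f" for f :: "octonion \<Rightarrow> real"
    using that by (intro zmod.subspaceI) (auto simp: linear_0 linear_add linear_scale)
  have "zmod.subspace {x. ?P x}"
    unfolding Collect_conj_eq
    by (intro zmod.subspace_inter sub linearI) (simp_all add: algebra_simps)
  moreover have "cd_basis \<subseteq> {x. ?P x}"
    by (simp add: oct_mult_nth oct_h_nth oe_nth)
  ultimately have "coxeter_dickson \<subseteq> {x. ?P x}"
    unfolding coxeter_dickson_def int_span_def by (rule zmod.span_minimal[rotated])
  then show "x \<in> coxeter_dickson \<Longrightarrow> ?P x"
    by blast
next
  assume "?P x"
  then obtain m0 m1 m2 m3 m4 m5 m6 m7 where m:
    "2 * x$0 = of_int m0" "2 * x$1 = of_int m1" "2 * x$2 = of_int m2" "2 * x$3 = of_int m3"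
    "x$1 + x$2 + x$3 + x$4 = of_int m4" "x$0 + x$1 + x$2 + x$5 = of_int m5"
    "x$0 + x$2 + x$3 + x$6 = of_int m6" "x$0 + x$1 + x$3 + x$7 = of_int m7"
    unfolding Ints_def by blast
  let ?c = "\<lambda>(n::int) (b::octonion). of_int n *\<^sub>R b"
  define n4 n5 n6 n7 where n:
    "n4 = 2 * m4 + 2 * m6 - 2 * m7 - 2 * m2 - m3"
    "n5 = 2 * m7 - 2 * m5 + m2 - m3"
    "n6 = 2 * m6 - 2 * m5 + m1 - m3"
    "n7 = m0 + m1 + m2 - 2 * m5"
  have x: "x$0 = m0 / 2" "x$1 = m1 / 2" "x$2 = m2 / 2" "x$3 = m3 / 2"
    "x$4 = m4 - m1 / 2 - m2 / 2 - m3 / 2" "x$5 = m5 - m0 / 2 - m1 / 2 - m2 / 2"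
    "x$6 = m6 - m0 / 2 - m2 / 2 - m3 / 2" "x$7 = m7 - m0 / 2 - m1 / 2 - m3 / 2"
    using m by linarith+
  \<comment> \<open>The coefficients solve the linear system expressing \<open>x\<close> in the
    generators; what matters is that all of them are integers.\<close>
  have "x = ?c (m0 + m1 + m2 - m3 - 3 * m5 + m6 + m7) (oe 0)
    + ?c (m2 + m3 - m4 + m5 - 2 * m6 + m7) (oe 1) + ?c (2 * m2 - m4 - m5 - m6 + 2 * m7) (oe 2)
    + ?c (m2 + m3 - m4 - m6 + m7) (oe 3) + ?c n4 oct_h + ?c n5 (oe 1 \<cdot>\<^sub>O oct_h)
    + ?c n6 (oe 2 \<cdot>\<^sub>O oct_h) + ?c n7 (oe 3 \<cdot>\<^sub>O oct_h)"
    by (simp add: vec_eq_iff forall_8 oct_mult_nth oct_h_nth oe_nth n x field_simps)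
  also have "\<dots> \<in> coxeter_dickson"
    unfolding coxeter_dickson_def int_span_def
    by (intro zmod.span_add zmod.span_scale zmod.span_base) simp_all
  finally show "x \<in> coxeter_dickson" .
qed

text \<open>The preimage of the order under a real linear map is again a subgroup, so it suffices
  that it contains the generators.\<close>

lemma coxeter_dickson_linear_image:
  assumes "linear f" "f ` cd_basis \<subseteq> coxeter_dickson" "x \<in> coxeter_dickson"
  shows "f x \<in> coxeter_dickson"
proof -
  have "zmod.subspace {x. f x \<in> coxeter_dickson}"
    unfolding coxeter_dickson_def int_span_def
    using assms(1)
    by (intro zmod.subspaceI)
      (simp_all add: linear_0 linear_add linear_scale zmod.span_zero zmod.span_add zmod.span_scale)
  with assms show ?thesis
    using zmod.span_minimal[of cd_basis "{x. f x \<in> coxeter_dickson}"]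
    unfolding coxeter_dickson_def int_span_def by blast
qed

lemma coxeter_dickson_cnj: "x \<in> coxeter_dickson \<Longrightarrow> oct_cnj x \<in> coxeter_dickson"
  by (rule coxeter_dickson_linear_image[OF linear_oct_cnj])
    (simp_all add: coxeter_dickson_iff oct_cnj_nth oct_mult_nth oct_h_nth oe_nth)

lemma coxeter_dickson_tau: "x \<in> coxeter_dickson \<Longrightarrow> oct_tau x \<in> coxeter_dickson"
  by (rule coxeter_dickson_linear_image[OF linear_oct_tau])
    (simp_all add: coxeter_dickson_iff oct_tau_nth oct_mult_nth oct_h_nth oe_nth)

lemma coxeter_dickson_mult:
  assumes "x \<in> coxeter_dickson" "y \<in> coxeter_dickson"
  shows "x \<cdot>\<^sub>O y \<in> coxeter_dickson"
proof -
  \<comment> \<open>The 64 products of generators are tested by the coordinate criterion.\<close>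
  have "a \<cdot>\<^sub>O b \<in> coxeter_dickson" if "a \<in> cd_basis" "b \<in> cd_basis" for a b
    using that unfolding coxeter_dickson_iff
    by (elim insertE emptyE; simp add: oct_mult_nth oct_h_nth oe_nth)
  moreover have lin: "linear (\<lambda>y. a \<cdot>\<^sub>O y)" "linear (\<lambda>x. x \<cdot>\<^sub>O a)" for a
    using bilinear_oct_mult by (simp_all add: bilinear_def)
  \<comment> \<open>Linearity extends the claim first in the right factor, then in the left
    one.\<close>
  ultimately have "a \<cdot>\<^sub>O y \<in> coxeter_dickson" if "a \<in> cd_basis" for a
    using that by (intro coxeter_dickson_linear_image[OF lin(1) _ assms(2)] image_subsetI)
  then show ?thesis
    by (intro coxeter_dickson_linear_image[OF lin(2) _ assms(1)] image_subsetI)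
qed

lemma para_mult_one: "para_mult (oe 0) x = oct_cnj x" "para_mult x (oe 0) = oct_cnj x"
  by (simp_all add: para_mult_def)

section \<open>Commutation under the Okubo product\<close>

lemma okubo_mult_commutes_imp_zero:
  assumes "\<And>k. okubo_mult p (oe k) = okubo_mult (oe k) p"
  shows "p = 0"
proof -
  define c where "c = oct_cnj p"
  have c: "(oct_tau c \<cdot>\<^sub>O oct_tau (oct_tau (oct_cnj (oe k)))) $ j =
      (oct_tau (oct_cnj (oe k)) \<cdot>\<^sub>O oct_tau (oct_tau c)) $ j" for k j
    using assms[of k] by (simp add: okubo_mult_def c_def numeral_2_eq_2)
  note nth = oct_mult_nth oct_tau_nth oct_cnj_nth oe_nth
  \<comment> \<open>For \<open>oe 0\<close> the equation says that \<open>oct_tau c\<close> equals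
    \<open>oct_tau (oct_tau c)\<close>, so \<open>oct_tau\<close> fixes \<open>c\<close>.\<close>
  have "c$2 = c$1 \<and> c$4 = - c$1 \<and> c$6 = c$7 \<and> c$5 = - c$7"
    using c[of 0 2] c[of 0 4] c[of 0 6] c[of 0 1] c[of 0 5] c[of 0 7] by (simp add: nth)
  \<comment> \<open>As \<open>oct_tau\<close> fixes both \<open>c\<close> and \<open>oe 3\<close>,
    now \<open>c\<close> commutes with \<open>oe 3\<close> and lies in the real span of
    \<open>oe 0\<close> and \<open>oe 3\<close>.\<close>
  moreover have "c$1 = 0 \<and> c$7 = 0"
    using c[of 3 1] c[of 3 2] c[of 3 4] c[of 3 5] c[of 3 6] c[of 3 7] calculation by (simp add: nth)
  \<comment> \<open>For \<open>oe 1\<close> the equation says that \<open>c\<close> times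
    \<open>oe 4\<close> equals minus \<open>oe 2\<close> times \<open>c\<close>. The left side lies
    in the span of \<open>oe 4\<close> and \<open>oe 5\<close>, the right side in that of
    \<open>oe 2\<close> and \<open>oe 6\<close>, so both vanish.\<close>
  moreover have "c$0 = 0 \<and> c$3 = 0"
    using c[of 1 2] c[of 1 4] c[of 1 6] c[of 1 5] calculation by (simp add: nth)
  ultimately have "c = 0"
    by (simp add: vec_eq_iff forall_8)
  then show ?thesis
    by (metis c_def oct_cnj_cnj oct_norm_cnj oct_norm_eq_0_iff)
qed

section \<open>Counting the roots\<close>

text \<open>An executable enumeration of integer vectors of length \<open>n\<close> with squared
  length \<open>s\<close>. Entries stop at absolute value 2, which is complete as long as
  \<open>s\<close> is below 9.\<close>

fun square_sum_lists :: "nat \<Rightarrow> int \<Rightarrow> int list list" where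
  "square_sum_lists 0 s = (if s = 0 then [[]] else [])"
| "square_sum_lists (Suc n) s = map (Cons 0) (square_sum_lists n s)
     @ (if s \<ge> 1 then map (Cons 1) (square_sum_lists n (s - 1))
           @ map (Cons (- 1)) (square_sum_lists n (s - 1)) else [])
     @ (if s \<ge> 4 then map (Cons 2) (square_sum_lists n (s - 4))
           @ map (Cons (- 2)) (square_sum_lists n (s - 4)) else [])"

lemma sum_list_squares_nonneg: "(\<Sum>y\<leftarrow>ys. y\<^sup>2) \<ge> (0::int)"
  by (rule sum_list_nonneg) auto

text \<open>A head of absolute value at least 3 contributes at least 9, so the five branches are
  exhaustive.\<close>

lemma set_square_sum_lists:
  "s < 9 \<Longrightarrow> set (square_sum_lists n s) = {ys. length ys = n \<and> (\<Sum>y\<leftarrow>ys. y\<^sup>2) = s}"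
proof (induction n arbitrary: s)
  case (Suc n)
  have *: "y \<in> {0, 1, -1, 2, -2}" if "y\<^sup>2 + (\<Sum>y\<leftarrow>ys. y\<^sup>2) = s" for y :: int and ys
  proof -
    have "\<bar>y\<bar>\<^sup>2 < 3\<^sup>2"
      using that Suc.prems sum_list_squares_nonneg[of ys] by simp
    then have "\<bar>y\<bar> < 3"
      by (rule power2_less_imp_less) simp
    then show ?thesis by auto
  qed
  show ?case
    apply (rule set_eqI)
    subgoal for ys
      using * sum_list_squares_nonneg[of "tl ys"] Suc
      by (cases ys) (fastforce simp: image_iff)+
    done
qed auto

lemma distinct_square_sum_lists: "distinct (square_sum_lists n s)"
  by (induction n arbitrary: s) (auto simp: distinct_map)

text \<open>The parity checks of the extended Hamming code, applied to the coordinates of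
  \<open>2x\<close>.\<close>

definition cd_parity :: "int list \<Rightarrow> bool" where
  "cd_parity ys \<longleftrightarrow> even (ys!1 + ys!2 + ys!3 + ys!4 :: int) \<and> even (ys!0 + ys!1 + ys!2 + ys!5)
    \<and> even (ys!0 + ys!2 + ys!3 + ys!6) \<and> even (ys!0 + ys!1 + ys!3 + ys!7)"

text \<open>The zero word gives the 16 vectors with one entry 2 or -2. Each of the 14 words of
  weight 4 gives 16 sign patterns, and 16 + 14 * 16 = 240.\<close>

lemma length_cd_parity: "length (filter cd_parity (square_sum_lists 8 4)) = 240"
  by code_simp

text \<open>Doubling the coordinates turns the search for roots into one over integer lists, with
  squared length 4 in place of norm 1.\<close>

definition half_oct :: "int list \<Rightarrow> octonion" where
  "half_oct ys = (\<Sum>i<8. (of_int (ys ! i) / 2) *\<^sub>R oe (of_nat i))"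

lemma half_oct_nth:
  "half_oct ys $ 0 = of_int (ys!0) / 2" "half_oct ys $ 1 = of_int (ys!1) / 2"
  "half_oct ys $ 2 = of_int (ys!2) / 2" "half_oct ys $ 3 = of_int (ys!3) / 2"
  "half_oct ys $ 4 = of_int (ys!4) / 2" "half_oct ys $ 5 = of_int (ys!5) / 2"
  "half_oct ys $ 6 = of_int (ys!6) / 2" "half_oct ys $ 7 = of_int (ys!7) / 2"
  by (simp_all add: half_oct_def oe_nth numeral_eq_Suc lessThan_Suc)

lemma all_less_8:
  "(\<forall>i<8. P i) \<longleftrightarrow> P 0 \<and> P 1 \<and> P 2 \<and> P 3 \<and> P 4 \<and> P 5 \<and> P 6 \<and> P (7::nat)"
  by (auto simp: numeral_eq_Suc All_less_Suc)

lemma inj_on_half_oct: "inj_on half_oct {ys. length ys = 8}"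
  by (rule inj_onI) (simp add: list_eq_iff_nth_eq all_less_8 vec_eq_iff forall_8 half_oct_nth)

lemma half_in_Ints_iff: "of_int n / (2::real) \<in> \<int> \<longleftrightarrow> even n"
proof
  assume "of_int n / (2::real) \<in> \<int>"
  then obtain m where "of_int n / (2::real) = of_int m"
    by (auto simp: Ints_def)
  then have "n = 2 * m" by linarith
  then show "even n" by simp
qed auto

lemma half_oct_in_coxeter_dickson_iff: "half_oct ys \<in> coxeter_dickson \<longleftrightarrow> cd_parity ys"
proof -
  \<comment> \<open>Over a common denominator, integrality of a sum of four halves becomes evenness
    of the numerator.\<close>
  have "of_int a / 2 + of_int b / 2 + of_int c / 2 + of_int d / (2::real) = of_int (a + b + c + d) / 2" for a b c d
    by simp
  then show ?thesis
    unfolding coxeter_dickson_iff half_oct_nth cd_parity_def by (simp only: half_in_Ints_iff) simp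
qed

lemma coxeter_dickson_imp_half_oct:
  assumes "x \<in> coxeter_dickson"
  shows "\<exists>ys. length ys = 8 \<and> x = half_oct ys"
proof -
  \<comment> \<open>Each of the coordinates 4 to 7 completes one of the four integral sums, whose
    other three terms are half-integers.\<close>
  have D: "2 * d \<in> \<int>" if "2 * a \<in> \<int>" "2 * b \<in> \<int>" "2 * c \<in> \<int>" "a + b + c + d \<in> \<int>" for a b c d :: real
  proof -
    have "2 * d = 2 * (a + b + c + d) - 2 * a - 2 * b - 2 * c" by simp
    also have "\<dots> \<in> \<int>" using that by (metis Ints_diff Ints_mult Ints_numeral)
    finally show ?thesis .
  qed
  have "2 * x$0 \<in> \<int>" "2 * x$1 \<in> \<int>" "2 * x$2 \<in> \<int>" "2 * x$3 \<in> \<int>"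
    "2 * x$4 \<in> \<int>" "2 * x$5 \<in> \<int>" "2 * x$6 \<in> \<int>" "2 * x$7 \<in> \<int>"
    using assms unfolding coxeter_dickson_iff by (blast intro: D)+
  then obtain a0 a1 a2 a3 a4 a5 a6 a7 where a:
    "2 * x$0 = of_int a0" "2 * x$1 = of_int a1" "2 * x$2 = of_int a2" "2 * x$3 = of_int a3"
    "2 * x$4 = of_int a4" "2 * x$5 = of_int a5" "2 * x$6 = of_int a6" "2 * x$7 = of_int a7"
    by (elim Ints_cases) blast
  then have "x = half_oct [a0, a1, a2, a3, a4, a5, a6, a7]"
    by (simp add: vec_eq_iff forall_8 half_oct_nth)
  then show ?thesis
    by (intro exI[of _ "[a0, a1, a2, a3, a4, a5, a6, a7]"]) simp
qed

lemma oct_norm_half_oct: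
  assumes "length ys = 8"
  shows "oct_norm (half_oct ys) = of_int (\<Sum>y\<leftarrow>ys. y\<^sup>2) / 4"
proof -
  obtain a b c d e f g h where "ys = [a, b, c, d, e, f, g, h]"
    using assms by (auto simp: numeral_eq_Suc length_Suc_conv)
  then show ?thesis
    by (simp add: oct_norm_def sum_8 half_oct_nth power_divide)
qed

lemma cd_roots_eq: "cd_roots = half_oct ` set (filter cd_parity (square_sum_lists 8 4))"
proof -
  have "x \<in> cd_roots \<longleftrightarrow> (\<exists>ys. length ys = 8 \<and> x = half_oct ys \<and> cd_parity ys \<and> (\<Sum>y\<leftarrow>ys. y\<^sup>2) = 4)" for x
    unfolding cd_roots_def using coxeter_dickson_imp_half_oct[of x]
    by (fastforce simp: half_oct_in_coxeter_dickson_iff oct_norm_half_oct)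
  then show ?thesis
    by (auto simp: set_square_sum_lists)
qed

lemma card_cd_roots: "card cd_roots = 240"
proof -
  have "card cd_roots = card (set (filter cd_parity (square_sum_lists 8 4)))"
    unfolding cd_roots_eq
    by (intro card_image inj_on_subset[OF inj_on_half_oct]) (auto simp: set_square_sum_lists)
  also have "\<dots> = 240"
    by (simp only: distinct_card distinct_filter distinct_square_sum_lists length_cd_parity)
  finally show ?thesis .
qed

text \<open>An infinite set has \<open>card\<close> equal to 0 by convention, so the value 240
  entails finiteness.\<close>

lemma finite_cd_roots: "finite cd_roots"
  using card_cd_roots card.infinite by fastforce

section \<open>Closure properties of the roots\<close>

lemma cd_roots_cnj: "x \<in> cd_roots \<Longrightarrow> oct_cnj x \<in> cd_roots"
  by (simp add: cd_roots_def coxeter_dickson_cnj oct_norm_cnj)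

lemma cd_roots_tau: "x \<in> cd_roots \<Longrightarrow> oct_tau x \<in> cd_roots"
  by (simp add: cd_roots_def coxeter_dickson_tau oct_norm_tau)

lemma cd_roots_mult: "x \<in> cd_roots \<Longrightarrow> y \<in> cd_roots \<Longrightarrow> x \<cdot>\<^sub>O y \<in> cd_roots"
  by (simp add: cd_roots_def coxeter_dickson_mult oct_norm_mult)

text \<open>Only \<open>oe 0\<close> to \<open>oe 3\<close> are among the generators; the coordinate
  criterion also covers \<open>oe 4\<close> to \<open>oe 7\<close>.\<close>

lemma oe_in_cd_roots: "oe k \<in> cd_roots"
proof -
  have "\<forall>k. oe k \<in> cd_roots"
    by (simp add: forall_8 cd_roots_def coxeter_dickson_iff oct_norm_def sum_8 oe_nth)
  then show ?thesis ..
qed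

lemma cd_roots_nonzero: "x \<in> cd_roots \<Longrightarrow> x \<noteq> 0"
  by (auto simp: cd_roots_def oct_norm_def)

section \<open>Quasigroup structure\<close>

text \<open>An injective self-map of a finite set is bijective.\<close>

lemma quasigroup_if_finite_cancellative:
  assumes "finite S" "closed_under S f"
    and "\<And>a x y. a \<in> S \<Longrightarrow> x \<in> S \<Longrightarrow> y \<in> S \<Longrightarrow> f a x = f a y \<Longrightarrow> x = y"
    and "\<And>a x y. a \<in> S \<Longrightarrow> x \<in> S \<Longrightarrow> y \<in> S \<Longrightarrow> f x a = f y a \<Longrightarrow> x = y"
  shows "quasigroup S f"
proof -
  have bij: "bij_betw g S S" if "inj_on g S" "g ` S \<subseteq> S" for g
    using endo_inj_surj[OF assms(1) that(2,1)] that(1) by (simp add: bij_betw_def)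
  have "bij_betw (f a) S S \<and> bij_betw (\<lambda>x. f x a) S S" if "a \<in> S" for a
  proof
    show "bij_betw (f a) S S"
    proof (rule bij)
      show "inj_on (f a) S"
        by (rule inj_onI) (rule assms(3)[OF that])
    qed (use assms(2) that in \<open>auto simp: closed_under_def\<close>)
    show "bij_betw (\<lambda>x. f x a) S S"
    proof (rule bij)
      show "inj_on (\<lambda>x. f x a) S"
        by (rule inj_onI) (rule assms(4)[OF that])
    qed (use assms(2) that in \<open>auto simp: closed_under_def\<close>)
  qed
  with assms(2) show ?thesis
    by (simp add: quasigroup_def)
qed

text \<open>Both products twist the octonion product by injective self-maps of the roots, so one
  cancellation argument serves both.\<close>

lemma quasigroup_cd_roots_isotope:
  assumes "inj g" "inj h" "\<And>x. x \<in> cd_roots \<Longrightarrow> g x \<in> cd_roots" "\<And>x. x \<in> cd_roots \<Longrightarrow> h x \<in> cd_roots"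
  shows "quasigroup cd_roots (\<lambda>x y. g x \<cdot>\<^sub>O h y)"
proof (rule quasigroup_if_finite_cancellative[OF finite_cd_roots])
  show "closed_under cd_roots (\<lambda>x y. g x \<cdot>\<^sub>O h y)"
    using assms by (simp add: closed_under_def cd_roots_mult)
next
  fix a x y assume S: "a \<in> cd_roots" "x \<in> cd_roots" "y \<in> cd_roots"
  show "x = y" if "g a \<cdot>\<^sub>O h x = g a \<cdot>\<^sub>O h y"
    using that S assms by (metis oct_mult_left_cancel cd_roots_nonzero injD)
  show "x = y" if "g x \<cdot>\<^sub>O h a = g y \<cdot>\<^sub>O h a"
    using that S assms by (metis oct_mult_right_cancel cd_roots_nonzero injD)
qed

lemma quasigroup_para_mult: "quasigroup cd_roots para_mult"
proof -
  have eq: "para_mult = (\<lambda>x y. oct_cnj x \<cdot>\<^sub>O oct_cnj y)"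
    by (simp add: fun_eq_iff para_mult_def)
  show ?thesis
    unfolding eq by (intro quasigroup_cd_roots_isotope inj_oct_cnj cd_roots_cnj)
qed

lemma quasigroup_okubo_mult: "quasigroup cd_roots okubo_mult"
proof -
  have eq: "okubo_mult = (\<lambda>x y. (oct_tau \<circ> oct_cnj) x \<cdot>\<^sub>O (oct_tau \<circ> oct_tau \<circ> oct_cnj) y)"
    by (simp add: fun_eq_iff okubo_mult_def numeral_2_eq_2)
  have "inj (oct_tau \<circ> oct_cnj)" "inj (oct_tau \<circ> oct_tau \<circ> oct_cnj)"
    by (intro inj_compose inj_oct_tau inj_oct_cnj)+
  then show ?thesis
    unfolding eq by (rule quasigroup_cd_roots_isotope) (simp_all add: cd_roots_cnj cd_roots_tau)
qed

section \<open>Identities and paraunits\<close>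

text \<open>The involution is conjugation. It reverses the octonion product, and hence also the
  para-octonionic one.\<close>

lemma paraunit_para_mult: "paraunit cd_roots para_mult (oe 0)"
  unfolding paraunit_def involution_on_def
  by (intro conjI exI[of _ oct_cnj])
    (auto simp: oe_in_cd_roots cd_roots_cnj para_mult_one, simp add: para_mult_def oct_cnj_mult)

text \<open>Testing \<open>u\<close> against \<open>oe 0\<close> forces \<open>u = oe 0\<close>, but
  that element acts by conjugation and moves \<open>oe 1\<close>.\<close>

lemma no_identity_para_mult: "\<not> identity_elt cd_roots para_mult u"
proof
  assume u: "identity_elt cd_roots para_mult u"
  then have "oct_cnj u = oe 0"
    using oe_in_cd_roots[of 0] by (auto simp: identity_elt_def para_mult_one)
  then have "u = oe 0"
    by (metis oct_cnj_cnj oct_cnj_one)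
  then have "oct_cnj (oe 1) = oe 1"
    using u oe_in_cd_roots[of 1] by (auto simp: identity_elt_def para_mult_one)
  then have "oct_cnj (oe 1) $ 1 = oe 1 $ 1" by simp
  then show False
    by (simp add: oct_cnj_nth oe_nth)
qed

text \<open>The basis vectors are roots and so may serve as test elements, while no root is zero.
  This is the common obstruction to identities and paraunits.\<close>

lemma no_okubo_commuting_root:
  assumes "p \<in> cd_roots" "\<And>x. x \<in> cd_roots \<Longrightarrow> okubo_mult p x = okubo_mult x p"
  shows False
  using okubo_mult_commutes_imp_zero[of p] assms oe_in_cd_roots cd_roots_nonzero by blast

theorem mainTheorem6:
  shows "card cd_roots = 240
    \<and> closed_under cd_roots para_mult
    \<and> closed_under cd_roots okubo_mult
    \<and> quasigroup cd_roots para_mult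
    \<and> quasigroup cd_roots okubo_mult
    \<and> paraunit cd_roots para_mult (oe 0)
    \<and> (\<forall>x\<in>cd_roots. para_mult (oe 0) x = oct_cnj x \<and> para_mult x (oe 0) = oct_cnj x)
    \<and> \<not> (\<exists>u. identity_elt cd_roots para_mult u)
    \<and> \<not> (\<exists>u. identity_elt cd_roots okubo_mult u)
    \<and> \<not> (\<exists>p. paraunit cd_roots okubo_mult p)"
proof (intro conjI)
  show "closed_under cd_roots para_mult" "closed_under cd_roots okubo_mult"
    using quasigroup_para_mult quasigroup_okubo_mult by (simp_all add: quasigroup_def)
  show "\<not> (\<exists>u. identity_elt cd_roots okubo_mult u)"
    using no_okubo_commuting_root by (fastforce simp: identity_elt_def)
  \<comment> \<open>Both products of a paraunit with \<open>x\<close> equal the involution at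
    \<open>x\<close>, so a paraunit commutes with every root.\<close>
  show "\<not> (\<exists>p. paraunit cd_roots okubo_mult p)"
    using no_okubo_commuting_root by (fastforce simp: paraunit_def)
qed (simp_all add: card_cd_roots quasigroup_para_mult quasigroup_okubo_mult paraunit_para_mult
  no_identity_para_mult para_mult_one)

end
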